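(* There exist degree sequences $\mathbf d_1,\mathbf d_2$ such that the double hyperarc shuffling method with $k$ steps does not sample uniformly from the spaces $$\mathcal H^{\mathrm{stub}}_{s,d}(\mathbf d_1),\quad \mathcal H^{\mathrm{stub}}_{d,m}(\mathbf d_2),\quad \mathcal H^{\mathrm{stub}}_{d}(\mathbf d_2),\quad \mathcal H^{\mathrm{stub}}_{m}(\mathbf d_2),\quad\text{and}\quad \mathcal H^{\mathrm{stub}}_{\emptyset}(\mathbf d_2),$$ for any $k$.
   Context: **Directed hypergraphs.** A directed hypergraph $H=(V,A)$ consists of a vertex set $V$ and a multiset $A=A(H)$ of hyperarcs; a hyperarc is a pair $a=(a^{\mathrm t},a^{\mathrm h})$ of multisets of elements of $V$ (its tail and head). $m_s(v)$ denotes the multiplicity of $v$ in a multiset $s$, and $\uplus$ is multiset union with multiplicities added. A hyperarc $a$ is a self-loop if $a^{\mathrm t}=a^{\mathrm h}$; it is degenerate if some vertex has multiplicity at least $2$ in $a^{\mathrm t}$ or in $a^{\mathrm h}$. Two hyperarcs $a_1,a_2$ of $H$ are multi-hyperarcs if $a_1^{\mathrm t}=a_2^{\mathrm t}$ and $a_1^{\mathrm h}=a_2^{\mathrm h}$. **Degrees.** $d_v^{\mathrm{in}}=\sum_{a\in A}m_{a^{\mathrm h}}(v)$, $d_v^{\mathrm{out}}=\sum_{a\in A}m_{a^{\mathrm t}}(v)$, $\delta_a^{\mathrm t}=|a^{\mathrm t}|$, $\delta_a^{\mathrm h}=|a^{\mathrm h}|$ (cardinalities with multiplicity). The degree sequence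 is $\mathbf d=(\mathbf d_V,\boldsymbol\delta_A)$ with $\mathbf d_V=((d_v^{\mathrm{in}},d_v^{\mathrm{out}}))_{v\in V}$ and $\boldsymbol\delta_A=((\delta_a^{\mathrm t},\delta_a^{\mathrm h}))_{a\in A}$. **Stub-labeled hypergraphs.** Each vertex $v$ has $d_v^{\mathrm{out}}$ distinct out-stubs and $d_v^{\mathrm{in}}$ distinct in-stubs. In a stub-labeled directed hypergraph the tail (head) of every hyperarc is a set of out-stubs (in-stubs), every out-stub lies in exactly one tail and every in-stub in exactly one head; two stub-labeled directed hypergraphs are the same iff their sets of linked stubs are the same. Self-loops, degenerate hyperarcs and multi-hyperarcs are determined using only the vertex labels (each stub replaced by its vertex). **Spaces.** For $x\subseteq\{s,d,m\}$, $\mathcal H^{\mathrm{stub}}_x(\mathbf d)$ is the set of all stub-labeled directed hypergraphs with degree sequence $\mathbf d$ that do not contain those of the features $s$ (self-loops), $d$ (degenerate hyperarcs), $m$ (multi-hyperarcs) that are not in $x$. For instance $\mathcal H^{\mathrm{stub}}_\emptyset(\mathbf d)$ forbids all three features. **Double hyperarc shuffle.** For two distinct hyperarcs $a,b$ of $H$ (distinct elements of the multiset $A(H)$), $S(a,b)$ is the set of pairs $(\hat a,\hat b)$ with $a^{\mathrm t}\uplus b^{\mathrm t}=\hat a^{\mathrm t}\uplus\hat b^{\mathrm t}$, $a^{\mathrm h}\uplus b^{\mathrm h}=\hat a^{\mathrm h}\uplus\hat b^{\mathrm h}$, $(\delta_a^{\mathrm t},\delta_a^{\mathrm h})=(\delta_{\hat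 a}^{\mathrm t},\delta_{\hat a}^{\mathrm h})$, $(\delta_b^{\mathrm t},\delta_b^{\mathrm h})=(\delta_{\hat b}^{\mathrm t},\delta_{\hat b}^{\mathrm h})$; for stub-labeled hypergraphs tails and heads here are sets of stubs. The shuffle $s(a,b|H)$ picks $(\hat a,\hat b)\in S(a,b)$ uniformly at random and outputs $H'$ with $A(H')=(A(H)\setminus\{a,b\})\uplus\{\hat a,\hat b\}$. **Double hyperarc shuffling method with $k$ steps** on a space $\mathcal H$, given an initial directed hypergraph $H_0\in\mathcal H$: for $i=0,1,\dots,k-1$, pick a pair of distinct hyperarcs $a_i,b_i$ of $H_i$ uniformly at random, perform $s(a_i,b_i|H_i)$, and let $H_{i+1}$ be the result if it lies in $\mathcal H$, and $H_{i+1}=H_i$ otherwise. The method is a random trial with outcome $H_k$. To sample uniformly from $\mathcal H$ means that the outcome of the method on $\mathcal H$ is uniformly distributed on $\mathcal H$. *)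

theory Defs
  imports "HOL-Probability.Probability"
begin

type_synonym 'v hyperarc = "'v multiset \<times> 'v multiset"

abbreviation tail :: "'v hyperarc \<Rightarrow> 'v multiset" where "tail \<equiv> fst"
abbreviation head :: "'v hyperarc \<Rightarrow> 'v multiset" where "head \<equiv> snd"

definition self_loop :: "'v hyperarc \<Rightarrow> bool" where
  "self_loop a \<longleftrightarrow> tail a = head a"

definition degenerate :: "'v hyperarc \<Rightarrow> bool" where
  "degenerate a \<longleftrightarrow> (\<exists>v. count (tail a) v \<ge> 2 \<or> count (head a) v \<ge> 2)"

definition in_degree :: "'v hyperarc multiset \<Rightarrow> 'v \<Rightarrow> nat" where
  "in_degree A v = (\<Sum>a\<in>#A. count (head a) v)"

definition out_degree :: "'v hyperarc multiset \<Rightarrow> 'v \<Rightarrow> nat" where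
  "out_degree A v = (\<Sum>a\<in>#A. count (tail a) v)"

definition arc_degree :: "'v hyperarc \<Rightarrow> nat \<times> nat" where
  "arc_degree a = (size (tail a), size (head a))"

text \<open>
  The hyperarcs of a directed hypergraph carry no names, so the family of hyperarc degrees is
  a multiset of (tail, head) degrees. The functions \<open>ds_in\<close> and \<open>ds_out\<close> matter on
  \<open>ds_verts\<close> only.
\<close>

record 'v degree_sequence =
  ds_verts :: "'v set"
  ds_in :: "'v \<Rightarrow> nat"
  ds_out :: "'v \<Rightarrow> nat"
  ds_arcs :: "(nat \<times> nat) multiset"

definition has_degree_sequence :: "'v hyperarc multiset \<Rightarrow> 'v degree_sequence \<Rightarrow> bool" where
  "has_degree_sequence A d \<longleftrightarrow>
     (\<forall>a\<in>#A. set_mset (tail a) \<subseteq> ds_verts d \<and> set_mset (head a) \<subseteq> ds_verts d) \<and>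
     (\<forall>v\<in>ds_verts d. in_degree A v = ds_in d v \<and> out_degree A v = ds_out d v) \<and>
     image_mset arc_degree A = ds_arcs d"


datatype 'v stub = OutStub (stub_vertex: 'v) nat | InStub (stub_vertex: 'v) nat

definition out_stubs :: "'v degree_sequence \<Rightarrow> 'v stub set" where
  "out_stubs d = {OutStub v i |v i. v \<in> ds_verts d \<and> i < ds_out d v}"

definition in_stubs :: "'v degree_sequence \<Rightarrow> 'v stub set" where
  "in_stubs d = {InStub v i |v i. v \<in> ds_verts d \<and> i < ds_in d v}"

text \<open>
  A stub-labeled hypergraph is a directed hypergraph on the stubs. The degree conditions say that
  each out-stub (in-stub) is in exactly one tail (head), with multiplicity one; hence all tails and
  heads are sets. Equality of such multisets of hyperarcs is equality of the linked sets of stubs.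
\<close>

definition stub_labeling :: "'v degree_sequence \<Rightarrow> 'v stub hyperarc multiset \<Rightarrow> bool" where
  "stub_labeling d G \<longleftrightarrow>
     (\<forall>a\<in>#G. set_mset (tail a) \<subseteq> out_stubs d \<and> set_mset (head a) \<subseteq> in_stubs d) \<and>
     (\<forall>s\<in>out_stubs d. out_degree G s = 1) \<and>
     (\<forall>s\<in>in_stubs d. in_degree G s = 1)"

definition forget_stubs :: "'v stub hyperarc multiset \<Rightarrow> 'v hyperarc multiset" where
  "forget_stubs G =
     image_mset (\<lambda>a. (image_mset stub_vertex (tail a), image_mset stub_vertex (head a))) G"

datatype feature = Self_Loops | Degenerate_Arcs | Multi_Arcs

fun contains_feature :: "'v hyperarc multiset \<Rightarrow> feature \<Rightarrow> bool" where
  "contains_feature A Self_Loops \<longleftrightarrow> (\<exists>a\<in>#A. self_loop a)"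
| "contains_feature A Degenerate_Arcs \<longleftrightarrow> (\<exists>a\<in>#A. degenerate a)"
| "contains_feature A Multi_Arcs \<longleftrightarrow> (\<exists>a. count A a \<ge> 2)"

definition stub_space ::
    "feature set \<Rightarrow> 'v degree_sequence \<Rightarrow> 'v stub hyperarc multiset set" where
  "stub_space x d = {G. stub_labeling d G \<and> has_degree_sequence (forget_stubs G) d \<and>
     (\<forall>f. f \<notin> x \<longrightarrow> \<not> contains_feature (forget_stubs G) f)}"


definition hyperarc_shuffles :: "'v hyperarc \<Rightarrow> 'v hyperarc \<Rightarrow> ('v hyperarc \<times> 'v hyperarc) set" where
  "hyperarc_shuffles a b = {(a', b').
     tail a + tail b = tail a' + tail b' \<and> head a + head b = head a' + head b' \<and>
     arc_degree a = arc_degree a' \<and> arc_degree b = arc_degree b'}"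

definition hyperarc_shuffle ::
    "'v hyperarc \<Rightarrow> 'v hyperarc \<Rightarrow> 'v hyperarc multiset \<Rightarrow> 'v hyperarc multiset pmf" where
  "hyperarc_shuffle a b A = map_pmf (\<lambda>(a', b'). (A - {#a, b#}) + {#a', b'#}) (pmf_of_set (hyperarc_shuffles a b))"

text \<open>
  All ordered pairs of distinct elements of a multiset, where two copies of the same hyperarc are
  distinct elements. Since \<open>hyperarc_shuffle\<close> treats both hyperarcs alike, a uniform ordered pair
  amounts to a uniform unordered pair.
\<close>

definition distinct_pairs :: "'a multiset \<Rightarrow> ('a \<times> 'a) multiset" where
  "distinct_pairs A = (\<Sum>a\<in>#A. image_mset (Pair a) (A - {#a#}))"

text \<open>With fewer than two hyperarcs there is no pair to pick, and the step leaves the input as it is.\<close>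

definition shuffle_step ::
    "'v hyperarc multiset set \<Rightarrow> 'v hyperarc multiset \<Rightarrow> 'v hyperarc multiset pmf" where
  "shuffle_step \<H> A =
     (if size A < 2 then return_pmf A
      else do {
        (a, b) \<leftarrow> pmf_of_multiset (distinct_pairs A);
        A' \<leftarrow> hyperarc_shuffle a b A;
        return_pmf (if A' \<in> \<H> then A' else A)
      })"

primrec shuffling_method ::
    "'v hyperarc multiset set \<Rightarrow> nat \<Rightarrow> 'v hyperarc multiset \<Rightarrow> 'v hyperarc multiset pmf" where
  "shuffling_method \<H> 0 A = return_pmf A"
| "shuffling_method \<H> (Suc k) A = shuffling_method \<H> k A \<bind> shuffle_step \<H>"

definition samples_uniformly ::
    "'v hyperarc multiset set \<Rightarrow> nat \<Rightarrow> 'v hyperarc multiset \<Rightarrow> bool" where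
  "samples_uniformly \<H> k A \<longleftrightarrow> shuffling_method \<H> k A = pmf_of_set \<H>"


text \<open>The sets to which \<open>pmf_of_set\<close> is applied are finite.\<close>

lemma finite_submultisets: "finite {X. X \<subseteq># M}"
proof (induction M)
  case (add a M)
  have "{X. X \<subseteq># add_mset a M} \<subseteq> {X. X \<subseteq># M} \<union> add_mset a ` {X. X \<subseteq># M}"
  proof
    fix X assume "X \<in> {X. X \<subseteq># add_mset a M}"
    then have X: "X \<subseteq># add_mset a M" by simp
    show "X \<in> {X. X \<subseteq># M} \<union> add_mset a ` {X. X \<subseteq># M}"
    proof (cases "a \<in># X")
      case True
      then obtain Y where "X = add_mset a Y" by (metis insert_DiffM)
      with X show ?thesis by auto
    next
      case False
      have "X - {#a#} \<subseteq># M" using X by (subst subset_eq_diff_conv) simp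
      with False have "X \<subseteq># M" by (simp add: diff_single_trivial)
      then show ?thesis by simp
    qed
  qed
  then show ?case by (rule finite_subset) (use add in simp)
qed simp

lemma finite_hyperarc_shuffles: "finite (hyperarc_shuffles a b)"
proof -
  have "hyperarc_shuffles a b \<subseteq>
     ({X. X \<subseteq># tail a + tail b} \<times> {X. X \<subseteq># head a + head b}) \<times>
     ({X. X \<subseteq># tail a + tail b} \<times> {X. X \<subseteq># head a + head b})"
    by (auto simp: hyperarc_shuffles_def)
  then show ?thesis
    by (rule finite_subset) (intro finite_SigmaI finite_submultisets)
qed

lemma hyperarc_shuffles_nonempty: "hyperarc_shuffles a b \<noteq> {}"
proof -
  have "(a, b) \<in> hyperarc_shuffles a b" by (simp add: hyperarc_shuffles_def)
  then show ?thesis by blast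
qed

lemma finite_out_stubs: "finite (ds_verts d) \<Longrightarrow> finite (out_stubs d)"
proof -
  assume "finite (ds_verts d)"
  moreover have "out_stubs d = (\<lambda>(v, i). OutStub v i) ` (SIGMA v:ds_verts d. {..<ds_out d v})"
    by (force simp: out_stubs_def)
  ultimately show ?thesis by simp
qed

lemma finite_in_stubs: "finite (ds_verts d) \<Longrightarrow> finite (in_stubs d)"
proof -
  assume "finite (ds_verts d)"
  moreover have "in_stubs d = (\<lambda>(v, i). InStub v i) ` (SIGMA v:ds_verts d. {..<ds_in d v})"
    by (force simp: in_stubs_def)
  ultimately show ?thesis by simp
qed

lemma subset_mset_set_if_degree_1:
  assumes "a \<in># G" "finite S" "set_mset (f a) \<subseteq> S" "\<forall>s\<in>S. (\<Sum>a\<in>#G. count (f a) s) = (1::nat)"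
  shows "f a \<subseteq># mset_set S"
proof (rule mset_subset_eqI)
  fix s
  show "count (f a) s \<le> count (mset_set S) s"
  proof (cases "s \<in> S")
    case True
    obtain G' where "G = add_mset a G'" using assms(1) by (metis insert_DiffM)
    then have "count (f a) s \<le> (\<Sum>a\<in>#G. count (f a) s)" by simp
    then show ?thesis using True assms by simp
  next
    case False
    then have "s \<notin># f a" using assms(3) by auto
    then show ?thesis by (simp add: not_in_iff)
  qed
qed

lemma finite_stub_space:
  assumes "finite (ds_verts d)"
  shows "finite (stub_space x d)"
proof -
  define B where "B = {X. X \<subseteq># mset_set (out_stubs d)} \<times> {X. X \<subseteq># mset_set (in_stubs d)}"
  have "finite B" unfolding B_def by (intro finite_SigmaI finite_submultisets)
  then have fin: "finite (mset ` {xs. set xs \<subseteq> B \<and> length xs = size (ds_arcs d)})"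
    by (intro finite_imageI finite_lists_length_eq)
  have "stub_space x d \<subseteq> mset ` {xs. set xs \<subseteq> B \<and> length xs = size (ds_arcs d)}"
  proof
    fix G assume G: "G \<in> stub_space x d"
    obtain xs where xs: "mset xs = G" using ex_mset by blast
    from G have "image_mset arc_degree (forget_stubs G) = ds_arcs d"
      by (simp add: stub_space_def has_degree_sequence_def)
    then have "size (image_mset arc_degree (forget_stubs G)) = size (ds_arcs d)" by (rule arg_cong)
    then have "size G = size (ds_arcs d)" by (simp add: forget_stubs_def)
    moreover have "a \<in> B" if a: "a \<in># G" for a
    proof -
      have lab: "stub_labeling d G" using G by (simp add: stub_space_def)
      have "tail a \<subseteq># mset_set (out_stubs d)"
        by (rule subset_mset_set_if_degree_1[OF a finite_out_stubs[OF assms]])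
          (use lab a in \<open>auto simp: stub_labeling_def out_degree_def\<close>)
      moreover have "head a \<subseteq># mset_set (in_stubs d)"
        by (rule subset_mset_set_if_degree_1[OF a finite_in_stubs[OF assms]])
          (use lab a in \<open>auto simp: stub_labeling_def in_degree_def\<close>)
      ultimately show ?thesis by (simp add: B_def mem_Times_iff)
    qed
    ultimately show "G \<in> mset ` {xs. set xs \<subseteq> B \<and> length xs = size (ds_arcs d)}"
      using xs by (intro image_eqI[of _ _ xs]) auto
  qed
  with fin show ?thesis by (rule finite_subset[rotated])
qed

end

theory Submission
  imports Defs
begin

text \<open>
  A shuffle on at least three hyperarcs leaves one of them untouched. Hence, if a property of
  hyperarcs holds for all or for none of the hyperarcs of each member of a space, the method
  never leaves the class it starts in. For \<open>d1\<close> the tails form a triangle or three loops (all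
  heads being the same vertex) and the property is degeneracy; for \<open>d2\<close> the hypergraphs are the
  two orientations of a directed triangle, and the property is the orientation of the arc.
\<close>

section \<open>Invariants of the shuffling method\<close>

lemma shuffle_step_keeps_arc:
  assumes "G' \<in> set_pmf (shuffle_step \<H> G)" "G \<in> \<H>" "size G \<ge> 3"
  shows "G' \<in> \<H> \<and> (\<exists>c. c \<in># G \<and> c \<in># G')"
proof -
  have nonempty: "G \<noteq> {#}" using assms(3) by auto
  obtain a b a' b' where "G' = G \<or> G' \<in> \<H> \<and> G' = (G - {#a, b#}) + {#a', b'#}"
    using assms by (fastforce simp: shuffle_step_def hyperarc_shuffle_def split: if_splits)
  then show ?thesis
  proof
    assume G': "G' \<in> \<H> \<and> G' = (G - {#a, b#}) + {#a', b'#}"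
    \<comment> \<open>Multiset subtraction removes at most two elements, whatever \<open>a\<close>
      and \<open>b\<close> are, so at least one of three hyperarcs survives.\<close>
    have "size G - size {#a, b#} \<le> size (G - {#a, b#})" by (rule diff_size_le_size_Diff)
    then have "G - {#a, b#} \<noteq> {#}" using assms(3) by auto
    then obtain c where "c \<in># G - {#a, b#}" by (meson multiset_nonemptyE)
    with G' show ?thesis by (metis in_diffD union_iff)
  next
    assume "G' = G"
    then show ?thesis using nonempty assms(2) by (metis multiset_nonemptyE)
  qed
qed

text \<open>Induction on \<open>k\<close>: the hyperarc common to consecutive hypergraphs carries
  the value of \<open>P\<close> over, and homogeneity of the new hypergraph spreads it to all its
  hyperarcs.\<close>

lemma shuffling_method_preserves_homogeneous:
  assumes size: "\<And>G. G \<in> \<H> \<Longrightarrow> size G \<ge> 3"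
    and homogeneous: "\<And>G a b. G \<in> \<H> \<Longrightarrow> a \<in># G \<Longrightarrow> b \<in># G \<Longrightarrow> P a = P b"
    and "G \<in> \<H>" "G' \<in> set_pmf (shuffling_method \<H> k G)" "a \<in># G" "a' \<in># G'"
  shows "P a = P a'"
proof -
  have "G' \<in> \<H> \<and> (\<forall>a'\<in>#G'. P a = P a')"
    using assms(4)
  proof (induction k arbitrary: G')
    case 0
    then have "G' = G" by simp
    then show ?case using homogeneous \<open>G \<in> \<H>\<close> \<open>a \<in># G\<close> by blast
  next
    case (Suc k)
    then obtain F where "F \<in> set_pmf (shuffling_method \<H> k G)"
      and G': "G' \<in> set_pmf (shuffle_step \<H> F)" by auto
    with Suc.IH have F: "F \<in> \<H>" "\<forall>a'\<in>#F. P a = P a'" by blast+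
    obtain c where c: "G' \<in> \<H>" "c \<in># F" "c \<in># G'"
      using shuffle_step_keeps_arc[OF G' F(1) size[OF F(1)]] by blast
    have "P a = P a'" if "a' \<in># G'" for a'
      using bspec[OF F(2) c(2)] homogeneous[OF c(1) c(3) that] by (rule trans)
    with c(1) show ?case by blast
  qed
  then show ?thesis using assms(6) by blast
qed

text \<open>A uniform outcome has all of the finite space as its support, so both \<open>F\<close>
  and \<open>G\<close> would be reachable from the initial hypergraph, and one of its hyperarcs
  would have to share the value of \<open>P\<close> with both \<open>a\<close> and
  \<open>b\<close>.\<close>

lemma not_samples_uniformly_if_homogeneous:
  assumes "finite \<H>"
    and size: "\<And>G. G \<in> \<H> \<Longrightarrow> size G \<ge> 3"
    and homogeneous: "\<And>G a b. G \<in> \<H> \<Longrightarrow> a \<in># G \<Longrightarrow> b \<in># G \<Longrightarrow> P a = P b"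
    and "F \<in> \<H>" "a \<in># F" "P a"
    and "G \<in> \<H>" "b \<in># G" "\<not> P b"
    and "H\<^sub>0 \<in> \<H>"
  shows "\<not> samples_uniformly \<H> k H\<^sub>0"
proof
  assume "samples_uniformly \<H> k H\<^sub>0"
  then have "set_pmf (shuffling_method \<H> k H\<^sub>0) = \<H>"
    using set_pmf_of_set[of \<H>] assms(1) \<open>F \<in> \<H>\<close> unfolding samples_uniformly_def by (metis empty_iff)
  moreover obtain c where "c \<in># H\<^sub>0"
    using size[OF \<open>H\<^sub>0 \<in> \<H>\<close>] by (cases H\<^sub>0) auto
  ultimately have "P c = P a" "P c = P b"
    using shuffling_method_preserves_homogeneous[where P = P and \<H> = \<H> and G = H\<^sub>0 and k = k]
      assms by metis+
  with \<open>P a\<close> \<open>\<not> P b\<close> show False by simp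
qed

section \<open>Passage from vertex labels to stub labels\<close>

definition forget_arc :: "'v stub hyperarc \<Rightarrow> 'v hyperarc" where
  "forget_arc a = (image_mset stub_vertex (tail a), image_mset stub_vertex (head a))"

lemma forget_stubs_eq: "forget_stubs G = image_mset forget_arc G"
  unfolding forget_stubs_def forget_arc_def ..

text \<open>Pulling \<open>P\<close> back along \<open>forget_arc\<close> reduces homogeneity to a
  statement on vertex-labeled hypergraphs, where the case analysis is small.\<close>

lemma not_samples_uniformly_stub_space:
  assumes "finite (ds_verts d)" "size (ds_arcs d) \<ge> 3"
    and homogeneous: "\<And>A a b. has_degree_sequence A d \<Longrightarrow>
      (\<And>f. f \<notin> x \<Longrightarrow> \<not> contains_feature A f) \<Longrightarrow> a \<in># A \<Longrightarrow> b \<in># A \<Longrightarrow> P a = P b"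
    and "F \<in> stub_space x d" "\<exists>a\<in>#forget_stubs F. P a"
    and "G \<in> stub_space x d" "\<exists>b\<in>#forget_stubs G. \<not> P b"
    and "H\<^sub>0 \<in> stub_space x d"
  shows "\<not> samples_uniformly (stub_space x d) k H\<^sub>0"
proof -
  obtain a b where ab: "a \<in># F" "P (forget_arc a)" "b \<in># G" "\<not> P (forget_arc b)"
    using assms(5,7) by (auto simp: forget_stubs_eq)
  have size: "size G \<ge> 3" if "G \<in> stub_space x d" for G
  proof -
    have "size (image_mset arc_degree (forget_stubs G)) = size (ds_arcs d)"
      using that by (simp add: stub_space_def has_degree_sequence_def)
    then show ?thesis using assms(2) by (simp add: forget_stubs_eq)
  qed
  have forget: "P (forget_arc a) = P (forget_arc b)"
    if "G \<in> stub_space x d" "a \<in># G" "b \<in># G" for G a b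
    by (rule homogeneous[of "forget_stubs G"]) (use that in \<open>auto simp: stub_space_def forget_stubs_eq\<close>)
  show ?thesis
    by (rule not_samples_uniformly_if_homogeneous[where P = "\<lambda>a. P (forget_arc a)",
          OF finite_stub_space[OF assms(1)] size forget assms(4) ab(1,2) assms(6) ab(3,4) assms(8)])
qed

section \<open>The two degree sequences and their witnesses\<close>

text \<open>Tails are the edges of a 2-regular multigraph on 0, 1, 2, and vertex 3 takes every head.
  Multi-hyperarcs are then parallel edges; forbidding them excludes the mixed case of a loop beside
  a double edge.\<close>

definition d1 :: "nat degree_sequence" where
  "d1 = \<lparr>ds_verts = {0, 1, 2, 3}, ds_in = (\<lambda>v. if v = 3 then 3 else 0),
    ds_out = (\<lambda>v. if v = 3 then 0 else 2), ds_arcs = {#(2, 1), (2, 1), (2, 1)#}\<rparr>"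

text \<open>These hypergraphs are the permutations of three points, with fixed points as self-loops.
  The derangements are the two 3-cycles.\<close>

definition d2 :: "nat degree_sequence" where
  "d2 = \<lparr>ds_verts = {0, 1, 2}, ds_in = (\<lambda>_. 1), ds_out = (\<lambda>_. 1),
    ds_arcs = {#(1, 1), (1, 1), (1, 1)#}\<rparr>"

lemma out_stubs_d1: "out_stubs d1 = {OutStub 0 0, OutStub 0 1, OutStub 1 0, OutStub 1 1, OutStub 2 0, OutStub 2 1}"
  by (auto simp: out_stubs_def d1_def less_2_cases_iff split: if_splits intro: exI[of _ 0] exI[of _ 1] exI[of _ 2])

lemma in_stubs_d1: "in_stubs d1 = {InStub 3 0, InStub 3 1, InStub 3 2}"
  by (auto simp: in_stubs_def d1_def)

lemma out_stubs_d2: "out_stubs d2 = {OutStub 0 0, OutStub 1 0, OutStub 2 0}"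
  by (auto simp: out_stubs_def d2_def)

lemma in_stubs_d2: "in_stubs d2 = {InStub 0 0, InStub 1 0, InStub 2 0}"
  by (auto simp: in_stubs_def d2_def)

definition triangle :: "nat stub hyperarc multiset" where
  "triangle = {#({#OutStub 0 0, OutStub 1 0#}, {#InStub 3 0#}),
    ({#OutStub 1 1, OutStub 2 0#}, {#InStub 3 1#}),
    ({#OutStub 2 1, OutStub 0 1#}, {#InStub 3 2#})#}"

definition three_loops :: "nat stub hyperarc multiset" where
  "three_loops = {#({#OutStub 0 0, OutStub 0 1#}, {#InStub 3 0#}),
    ({#OutStub 1 0, OutStub 1 1#}, {#InStub 3 1#}),
    ({#OutStub 2 0, OutStub 2 1#}, {#InStub 3 2#})#}"

definition cycle :: "nat stub hyperarc multiset" where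
  "cycle = {#({#OutStub 0 0#}, {#InStub 1 0#}), ({#OutStub 1 0#}, {#InStub 2 0#}),
    ({#OutStub 2 0#}, {#InStub 0 0#})#}"

definition reverse_cycle :: "nat stub hyperarc multiset" where
  "reverse_cycle = {#({#OutStub 1 0#}, {#InStub 0 0#}), ({#OutStub 2 0#}, {#InStub 1 0#}),
    ({#OutStub 0 0#}, {#InStub 2 0#})#}"

lemma d1_in_stub_space:
  assumes "G \<in> {triangle, three_loops}"
  shows "G \<in> stub_space {Self_Loops, Degenerate_Arcs} d1"
proof -
  have "stub_labeling d1 G"
    using assms by (auto simp: stub_labeling_def out_stubs_d1 in_stubs_d1 out_degree_def in_degree_def
        triangle_def three_loops_def)
  moreover have "has_degree_sequence (forget_stubs G) d1"
    using assms by (auto simp: has_degree_sequence_def d1_def out_degree_def in_degree_def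
        forget_stubs_def arc_degree_def triangle_def three_loops_def numeral_2_eq_2)
  moreover have "\<not> contains_feature (forget_stubs G) f" if "f \<notin> {Self_Loops, Degenerate_Arcs}" for f
    using that assms
    by (cases f) (auto simp: forget_stubs_def triangle_def three_loops_def add_eq_conv_ex
        split: if_splits)
  ultimately show ?thesis by (simp add: stub_space_def)
qed

lemma d2_in_stub_space:
  assumes "G \<in> {cycle, reverse_cycle}"
  shows "G \<in> stub_space x d2"
proof -
  have "stub_labeling d2 G"
    using assms by (auto simp: stub_labeling_def out_stubs_d2 in_stubs_d2 out_degree_def in_degree_def
        cycle_def reverse_cycle_def)
  moreover have "has_degree_sequence (forget_stubs G) d2"
    using assms by (auto simp: has_degree_sequence_def d2_def out_degree_def in_degree_def
        forget_stubs_def arc_degree_def cycle_def reverse_cycle_def)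
  moreover have "\<not> contains_feature (forget_stubs G) f" for f
    using assms
    by (cases f) (auto simp: forget_stubs_def self_loop_def degenerate_def cycle_def reverse_cycle_def
        split: if_splits)
  ultimately show ?thesis by (simp add: stub_space_def)
qed

section \<open>Degeneracy is all or nothing for \<open>d1\<close>\<close>

lemma size_eq_sum_count:
  assumes "finite S" "set_mset M \<subseteq> S"
  shows "size M = sum (count M) S"
  unfolding size_multiset_overloaded_eq
  by (rule sum.mono_neutral_left) (use assms in \<open>auto simp: not_in_iff\<close>)

text \<open>
  If \<open>a\<close> has a double vertex, then the tails of the other two hyperarcs share the two remaining
  vertices, each of them used twice; these tails are distinct, hence loops.
\<close>

lemma degenerate_d1_step:
  assumes "has_degree_sequence {#a, b, c#} d1" "\<not> contains_feature {#a, b, c#} Multi_Arcs"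
    and "degenerate a"
  shows "degenerate b"
proof -
  have deg: "count (tail a) v + count (tail b) v + count (tail c) v = (if v = 3 then 0 else 2)"
    "count (head a) v + count (head b) v + count (head c) v = (if v = 3 then 3 else 0)"
    if "v \<in> {0, 1, 2, 3}" for v
    using assms(1) that by (auto simp: has_degree_sequence_def d1_def in_degree_def out_degree_def)
  have arcs: "size (tail z) = 2 \<and> size (head z) = 1 \<and> set_mset (tail z) \<subseteq> {0, 1, 2, 3} \<and>
      set_mset (head z) \<subseteq> {0, 1, 2, 3}" if "z \<in># {#a, b, c#}" for z
  proof -
    have "arc_degree z \<in># ds_arcs d1"
      using assms(1) that by (metis has_degree_sequence_def image_eqI set_image_mset)
    then show ?thesis using assms(1) that by (auto simp: arc_degree_def d1_def has_degree_sequence_def)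
  qed
  have tail_size: "count (tail z) 0 + count (tail z) 1 + count (tail z) 2 + count (tail z) 3 = 2"
    and head_size: "count (head z) 0 + count (head z) 1 + count (head z) 2 + count (head z) 3 = 1"
    if "z \<in># {#a, b, c#}" for z
    using size_eq_sum_count[of "{0, 1, 2, 3}" "tail z"] size_eq_sum_count[of "{0, 1, 2, 3}" "head z"]
      arcs[OF that] by simp_all
  have eqI: "M = N" if "set_mset M \<subseteq> {0, 1, 2, 3}" "set_mset N \<subseteq> {0, 1, 2, 3}"
    "\<And>v. v \<in> {0, 1, 2, 3} \<Longrightarrow> count M v = count N v" for M N :: "nat multiset"
    using that by (intro multiset_eqI) (metis in_mono not_in_iff)
  \<comment> \<open>Each head is a single vertex and only vertex 3 has positive in-degree.\<close>
  have head_eq: "head b = head c"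
    by (rule eqI)
      (use arcs[of b] arcs[of c] deg(2)[of 0] deg(2)[of 1] deg(2)[of 2] deg(2)[of 3]
        head_size[of a] head_size[of b] head_size[of c] in auto)
  have "b \<noteq> c"
  proof
    assume "b = c"
    then have "count {#a, b, c#} b \<ge> 2" by simp
    then show False using assms(2) contains_feature.simps(3) by blast
  qed
  then have "tail b \<noteq> tail c" using head_eq by (auto simp: prod_eq_iff)
  then obtain w where w: "w \<in> {0, 1, 2, 3}" "count (tail b) w \<noteq> count (tail c) w"
  proof -
    have "set_mset (tail b) \<subseteq> {0, 1, 2, 3}" "set_mset (tail c) \<subseteq> {0, 1, 2, 3}"
      using arcs[of b] arcs[of c] by simp_all
    from eqI[OF this] \<open>tail b \<noteq> tail c\<close> show thesis using that by blast
  qed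
  from assms(3) obtain v where "count (tail a) v \<ge> 2 \<or> count (head a) v \<ge> 2"
    by (auto simp: degenerate_def)
  moreover have "count (head a) v \<le> 1"
    using count_le_size[of "head a" v] arcs[of a] by simp
  ultimately have v: "count (tail a) v \<ge> 2" by linarith
  then have "v \<in># tail a" by (intro count_inI) simp
  then have v_in: "v \<in> {0, 1, 2, 3}" using arcs[of a] by auto
  \<comment> \<open>Listing the possible values of \<open>v\<close> and of \<open>w\<close> turns
    the rest into linear arithmetic in the twelve tail counts.\<close>
  have "count (tail a) 0 \<ge> 2 \<or> count (tail a) 1 \<ge> 2 \<or> count (tail a) 2 \<ge> 2 \<or> count (tail a) 3 \<ge> 2"
    using v v_in by auto
  moreover have "count (tail b) 0 \<noteq> count (tail c) 0 \<or> count (tail b) 1 \<noteq> count (tail c) 1 \<or>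
      count (tail b) 2 \<noteq> count (tail c) 2 \<or> count (tail b) 3 \<noteq> count (tail c) 3"
    using w by auto
  moreover note deg(1)[of 0, simplified] deg(1)[of 1, simplified] deg(1)[of 2, simplified]
    deg(1)[of 3, simplified] tail_size[of a, simplified] tail_size[of b, simplified]
    tail_size[of c, simplified]
  ultimately have "count (tail b) 0 \<ge> 2 \<or> count (tail b) 1 \<ge> 2 \<or> count (tail b) 2 \<ge> 2"
    unfolding One_nat_def by (elim disjE) linarith+
  then show ?thesis by (auto simp: degenerate_def)
qed

text \<open>Any two different hyperarcs can be put first in the triple, in either order, so the
  one-sided step gives both implications.\<close>

lemma degenerate_d1:
  assumes "has_degree_sequence A d1" "\<not> contains_feature A Multi_Arcs" "a \<in># A" "b \<in># A"
  shows "degenerate a = degenerate b"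
proof -
  have "size (image_mset arc_degree A) = 3" using assms(1) by (simp add: has_degree_sequence_def d1_def)
  then have size: "size A = 3" by simp
  have "degenerate b" if "a \<in># A" "b \<in># A" "degenerate a" for a b
  proof (cases "a = b")
    case False
    with that have "b \<in># A - {#a#}" by (metis insert_noteq_member insert_DiffM)
    then obtain B where B: "A = {#a, b#} + B"
      using \<open>a \<in># A\<close> by (metis insert_DiffM union_mset_add_mset_left add_0)
    with size have "size B = 1" by simp
    then obtain c where "B = {#c#}" using size_1_singleton_mset by blast
    then show ?thesis using degenerate_d1_step[of a b c] assms that B by (simp add: add_mset_commute)
  qed (use that in simp)
  then show ?thesis using assms by blast
qed

section \<open>Classification for \<open>d2\<close> without self-loops\<close>

text \<open>Every vertex is the tail of a hyperarc to another vertex. These three hyperarcs exhaust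
  \<open>A\<close>, and of the eight choices of heads only two give every vertex in-degree
  1.\<close>

lemma d2_no_self_loops:
  assumes deg: "has_degree_sequence A d2" and loops: "\<not> contains_feature A Self_Loops"
  shows "A = forget_stubs cycle \<or> A = forget_stubs reverse_cycle"
proof -
  have "size (image_mset arc_degree A) = 3" using deg by (simp add: has_degree_sequence_def d2_def)
  then have size: "size A = 3" by simp
  have ex: "\<exists>w\<in>{0, 1, 2} - {v}. ({#v#}, {#w#}) \<in># A" if v: "v \<in> {0, 1, 2}" for v
  proof -
    have "out_degree A v \<noteq> 0" using deg v by (auto simp: has_degree_sequence_def d2_def)
    then obtain a where a: "a \<in># A" "v \<in># tail a"
      by (auto simp: out_degree_def)
    have "arc_degree a \<in># ds_arcs d2"
      using deg a by (metis has_degree_sequence_def image_eqI set_image_mset)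
    then have "size (tail a) = 1" "size (head a) = 1" by (auto simp: arc_degree_def d2_def)
    then obtain u w where uw: "a = ({#u#}, {#w#})"
      by (metis size_1_singleton_mset prod.collapse)
    moreover have "w \<noteq> u" using loops a uw by (auto simp: self_loop_def)
    moreover have "w \<in> {0, 1, 2}" using deg a uw by (auto simp: has_degree_sequence_def d2_def)
    ultimately show ?thesis using a by auto
  qed
  obtain x y z where xyz: "x \<in> {1, 2}" "y \<in> {0, 2}" "z \<in> {0, 1}"
    and mem: "({#0#}, {#x#}) \<in># A" "({#1#}, {#y#}) \<in># A" "({#2#}, {#z#}) \<in># A"
    using ex[of 0] ex[of 1] ex[of 2] by auto
  let ?B = "{#({#0#}, {#x#}), ({#1#}, {#y#}), ({#2#}, {#z#})#}"
  \<comment> \<open>The tails differ, so each hyperarc occurs once in \<open>?B\<close> and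
    membership in \<open>A\<close> is enough.\<close>
  have "?B \<subseteq># A"
    using mem by (auto intro!: mset_subset_eqI simp: Suc_le_eq)
  moreover from this have "size (A - ?B) = 0" using size by (simp add: size_Diff_submset)
  ultimately have A: "A = ?B" by (metis size_eq_0_iff_empty subset_mset.diff_add add_0)
  have "in_degree A v = 1" if "v \<in> {0, 1, 2}" for v
    using deg that by (auto simp: has_degree_sequence_def d2_def)
  from this[of 0] this[of 1] this[of 2]
  have "x = 1 \<and> y = 2 \<and> z = 0 \<or> x = 2 \<and> y = 0 \<and> z = 1"
    using xyz unfolding A in_degree_def by (elim insertE emptyE) simp_all
  then show ?thesis
    by (elim disjE) (simp_all add: A forget_stubs_def cycle_def reverse_cycle_def add_mset_commute)
qed

section \<open>Failure of uniform sampling\<close>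

lemma not_samples_uniformly_d1:
  assumes "H\<^sub>0 \<in> stub_space {Self_Loops, Degenerate_Arcs} d1"
  shows "\<not> samples_uniformly (stub_space {Self_Loops, Degenerate_Arcs} d1) k H\<^sub>0"
proof (rule not_samples_uniformly_stub_space[where P = degenerate, OF _ _ _
      d1_in_stub_space[of three_loops] _ d1_in_stub_space[of triangle] _ assms])
  show "\<exists>a\<in>#forget_stubs three_loops. degenerate a"
    by (auto simp: three_loops_def forget_stubs_def degenerate_def)
  show "\<exists>a\<in>#forget_stubs triangle. \<not> degenerate a"
    by (auto simp: triangle_def forget_stubs_def degenerate_def)
  show "degenerate a = degenerate b" if "has_degree_sequence A d1"
    "\<And>f. f \<notin> {Self_Loops, Degenerate_Arcs} \<Longrightarrow> \<not> contains_feature A f" "a \<in># A" "b \<in># A" for A a b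
    using degenerate_d1[of A a b] that by blast
qed (simp_all add: d1_def)

text \<open>Leaving \<open>x\<close> general treats the four spaces on \<open>d2\<close> at once:
  only the absence of self-loops matters.\<close>

lemma not_samples_uniformly_d2:
  assumes "Self_Loops \<notin> x" and "H\<^sub>0 \<in> stub_space x d2"
  shows "\<not> samples_uniformly (stub_space x d2) k H\<^sub>0"
proof -
  \<comment> \<open>As the orientations share no hyperarc, membership in
    \<open>forget_stubs cycle\<close> is constant on each of them.\<close>
  have disjoint: "set_mset (forget_stubs cycle) \<inter> set_mset (forget_stubs reverse_cycle) = {}"
    by (simp add: forget_stubs_def cycle_def reverse_cycle_def)
  show ?thesis
  proof (rule not_samples_uniformly_stub_space[where P = "\<lambda>a. a \<in># forget_stubs cycle",
        OF _ _ _ d2_in_stub_space[of cycle] _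
        d2_in_stub_space[of reverse_cycle] _ assms(2)])
    show "(a \<in># forget_stubs cycle) = (b \<in># forget_stubs cycle)"
      if "has_degree_sequence A d2" "\<And>f. f \<notin> x \<Longrightarrow> \<not> contains_feature A f" "a \<in># A" "b \<in># A" for A a b
    proof -
      have "A = forget_stubs cycle \<or> A = forget_stubs reverse_cycle"
        using d2_no_self_loops[OF that(1) that(2)[OF assms(1)]] .
      then show ?thesis using that(3,4) disjoint by blast
    qed
    show "\<exists>a\<in>#forget_stubs cycle. a \<in># forget_stubs cycle"
      by (auto simp: cycle_def forget_stubs_def)
    show "\<exists>b\<in>#forget_stubs reverse_cycle. b \<notin># forget_stubs cycle"
      by (simp add: cycle_def reverse_cycle_def forget_stubs_def)
  qed (simp_all add: d2_def)
qed

theorem theorem3: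
  shows "\<exists>d1 d2 :: nat degree_sequence.
    finite (ds_verts d1) \<and> finite (ds_verts d2) \<and>
    (\<forall>\<H> \<in> {stub_space {Self_Loops, Degenerate_Arcs} d1,
             stub_space {Degenerate_Arcs, Multi_Arcs} d2,
             stub_space {Degenerate_Arcs} d2,
             stub_space {Multi_Arcs} d2,
             stub_space {} d2}.
       \<H> \<noteq> {} \<and> (\<forall>H\<^sub>0 \<in> \<H>. \<forall>k. \<not> samples_uniformly \<H> k H\<^sub>0))"
proof -
  \<comment> \<open>Nonemptiness keeps the claim on all initial hypergraphs from being
    vacuous.\<close>
  have "stub_space x d2 \<noteq> {}" for x
    using d2_in_stub_space[of cycle x] by blast
  moreover have "finite (ds_verts d1)" "finite (ds_verts d2)" by (simp_all add: d1_def d2_def)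
  ultimately show ?thesis
    using d1_in_stub_space[of triangle] not_samples_uniformly_d1 not_samples_uniformly_d2
    by (intro exI[of _ d1] exI[of _ d2]) auto
qed

end
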